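(* Let $n\ge 2$ be an integer. If $n\le 6$, then the anti-cycle $\overline{C_n}$ is a $2$-dot product graph. If $n\ge 7$, then $\overline{C_n}$ is not a $2$-dot product graph.
   Context: Graphs are finite and simple. A graph $G=(V,E)$ is a $d$-dot product graph if there are vectors $\mathbf{a}^u\in\mathbb{R}^d$ ($u\in V$) and a threshold $t>0$ such that, for all distinct $u,v\in V$, $uv\in E$ if and only if $\mathbf{a}^u\cdot\mathbf{a}^v\ge t$ (one may take $t=1$ by scaling). For $n\ge 2$, the anti-cycle $\overline{C_n}$ on $n$ vertices is the complement of the cycle $C_n$, i.e. every edge of $C_n$ is replaced by a non-edge and vice versa (for $n=2$, $C_2$ is read as a single edge on two vertices). *)

theory Defs
  imports "HOL-Analysis.Analysis" "Graph_Theory.Pair_Digraph"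
begin

text \<open>
  A finite simple graph is a \<^locale>\<open>pair_graph\<close>: finitely many vertices and a symmetric,
  irreflexive set of arcs, where an undirected edge \<open>uv\<close> is the pair of arcs \<open>(u, v)\<close>, \<open>(v, u)\<close>.
\<close>

text \<open>The dimension \<open>d\<close> is the cardinality of the index type, e.g. \<open>TYPE(2)\<close> for \<open>d = 2\<close>.\<close>

definition dot_product_graph :: "'d::finite itself \<Rightarrow> 'v pair_pre_digraph \<Rightarrow> bool" where
  "dot_product_graph d G \<longleftrightarrow>
    (\<exists>(a :: 'v \<Rightarrow> real ^ 'd) (t :: real). t > 0 \<and>
      (\<forall>u \<in> pverts G. \<forall>v \<in> pverts G. u \<noteq> v \<longrightarrow>
        ((u, v) \<in> parcs G \<longleftrightarrow> a u \<bullet> a v \<ge> t)))"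

definition complement_graph :: "'v pair_pre_digraph \<Rightarrow> 'v pair_pre_digraph" where
  "complement_graph G =
    \<lparr> pverts = pverts G,
      parcs = {(u, v). u \<in> pverts G \<and> v \<in> pverts G \<and> u \<noteq> v \<and> (u, v) \<notin> parcs G} \<rparr>"

text \<open>
  Meaningful for \<open>n \<ge> 2\<close>; for \<open>n = 2\<close> both disjuncts describe the same single edge.
\<close>

definition cycle_graph :: "nat \<Rightarrow> nat pair_pre_digraph" where
  "cycle_graph n =
    \<lparr> pverts = {..<n},
      parcs = {(u, v). u < n \<and> v < n \<and> (v = (u + 1) mod n \<or> u = (v + 1) mod n)} \<rparr>"

definition anti_cycle :: "nat \<Rightarrow> nat pair_pre_digraph" where
  "anti_cycle n = complement_graph (cycle_graph n)"

lemma pair_graph_complement_graph: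
  assumes "pair_graph G"
  shows "pair_graph (complement_graph G)"
proof -
  interpret pair_graph G by fact
  have s: "(u, v) \<in> parcs G \<longleftrightarrow> (v, u) \<in> parcs G" for u v
    using sym_arcs unfolding symmetric_def by (auto elim: symE)
  have f: "finite {(u, v). u \<in> pverts G \<and> v \<in> pverts G \<and> u \<noteq> v \<and> (u, v) \<notin> parcs G}"
    by (rule finite_subset[of _ "pverts G \<times> pverts G"]) auto
  show ?thesis
    by unfold_locales
      (use f s in \<open>auto simp: complement_graph_def symmetric_def arcs_ends_def arc_to_ends_def intro!: symI\<close>)
qed

lemma pair_graph_cycle_graph:
  assumes "n \<ge> 2"
  shows "pair_graph (cycle_graph n)"
proof -
  have f: "finite {(u, v). u < n \<and> v < n \<and> (v = (u + 1) mod n \<or> u = (v + 1) mod n)}"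
    by (rule finite_subset[of _ "{..<n} \<times> {..<n}"]) auto
  have l: "Suc u mod n \<noteq> u" if "u < n" for u
    using that assms by (cases "Suc u = n") auto
  show ?thesis
    by unfold_locales
      (use f l l[symmetric] in \<open>auto simp: cycle_graph_def symmetric_def arcs_ends_def arc_to_ends_def intro!: symI\<close>)
qed

lemma pair_graph_anti_cycle: "n \<ge> 2 \<Longrightarrow> pair_graph (anti_cycle n)"
  by (simp add: anti_cycle_def pair_graph_complement_graph pair_graph_cycle_graph)

end

theory Submission
  imports Defs
begin

text \<open>
  For \<open>n \<ge> 7\<close>: let \<open>ab\<close> and \<open>cd\<close> be non-edges such that all four pairs between them are edges.
  Then \<open>a \<bullet> b\<close> and \<open>c \<bullet> d\<close> cannot both be negative, so
  \<open>(a \<bullet> b) (c \<bullet> d) < t\<^sup>2 \<le> (a \<bullet> c) (b \<bullet> d)\<close>, and likewise with \<open>c\<close>, \<open>d\<close> swapped. By the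
  Binet-Cauchy identity in the plane, \<open>(a \<times> d) (b \<times> c)\<close> and \<open>(a \<times> c) (b \<times> d)\<close> are negative, which
  says that one of the angular sectors spanned by \<open>ab\<close> and \<open>cd\<close> is nested in the other.
  Consider the non-edges \<open>k = {k, k + 1}\<close> of the anti-cycle. Whether \<open>k\<close> is the inner or the outer
  one is the same for all partners \<open>k + i\<close> with \<open>3 \<le> i \<le> n - 3\<close>, because successive partners share
  a vertex. Hence \<open>k\<close> differs in type from both \<open>k + 3\<close> and \<open>k + 4\<close>, so consecutive non-edges have
  the same type, contradicting that \<open>k\<close> and \<open>k + 3\<close> differ.
\<close>

lemma dot_product_graph_anti_cycle_iff:
  "dot_product_graph TYPE('d::finite) (anti_cycle n) \<longleftrightarrow>
    (\<exists>(a :: nat \<Rightarrow> real ^ 'd) t. t > 0 \<and> (\<forall>u<n. \<forall>v<n. u \<noteq> v \<longrightarrow>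
      (t \<le> a u \<bullet> a v \<longleftrightarrow> v \<noteq> (u + 1) mod n \<and> u \<noteq> (v + 1) mod n)))"
  unfolding dot_product_graph_def anti_cycle_def complement_graph_def cycle_graph_def
  by (intro ex_cong1 conj_cong refl) auto

lemma inner_vector_2: "(vector [x, y] :: real ^ 2) \<bullet> vector [x', y'] = x * x' + y * y'"
  by (simp add: inner_vec_def sum_2)

lemma all_less_numeral:
  "(\<forall>u<numeral k. P u) \<longleftrightarrow> P (pred_numeral k) \<and> (\<forall>u<pred_numeral k. P u)"
  by (simp add: numeral_eq_Suc All_less_Suc)

lemma dot_product_graph_anti_cycle_le_6:
  assumes "2 \<le> n" and "n \<le> 6"
  shows "dot_product_graph TYPE(2) (anti_cycle n)"
proof -
  have representable: "dot_product_graph TYPE(2) (anti_cycle n)"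
    if "t > 0" and "\<forall>u<n. \<forall>v<n. u \<noteq> v \<longrightarrow>
      (t \<le> xs ! u \<bullet> xs ! v \<longleftrightarrow> v \<noteq> (u + 1) mod n \<and> u \<noteq> (v + 1) mod n)"
    for t n and xs :: "(real ^ 2) list"
    unfolding dot_product_graph_anti_cycle_iff using that by blast
  consider "n = 2" | "n = 3" | "n = 4" | "n = 5" | "n = 6"
    using assms by linarith
  then show ?thesis
  proof cases
    case 1
    show ?thesis unfolding 1
      by (rule representable[of 1 2 "[0, 0]"]) (simp_all add: all_less_numeral)
  next
    case 2
    show ?thesis unfolding 2
      by (rule representable[of 1 3 "[0, 0, 0]"]) (simp_all add: all_less_numeral)
  next
    case 3
    show ?thesis unfolding 3
      by (rule representable[of 1 4 "[vector [1, 0], vector [0, 1], vector [1, 0], vector [0, 1]]"])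
        (simp_all add: all_less_numeral inner_vector_2)
  next
    case 4
    show ?thesis unfolding 4
      by (rule representable[of 1 5 "[vector [-3, 2], vector [2, -3], vector [1, 3],
            vector [-2, -2], vector [1, 0]]"])
        (simp_all add: all_less_numeral inner_vector_2)
  next
    case 5
    \<comment> \<open>The threshold 14 is tight for these integer vectors: inner products over
      non-edges are at most 13.\<close>
    show ?thesis unfolding 5
      by (rule representable[of 14 6 "[vector [3, 0], vector [4, 3], vector [6, -4],
            vector [5, 6], vector [5, -2], vector [3, 1]]"])
        (simp_all add: all_less_numeral inner_vector_2)
  qed
qed

definition cross2 :: "real ^ 2 \<Rightarrow> real ^ 2 \<Rightarrow> real" where
  "cross2 x y = x $ 1 * y $ 2 - x $ 2 * y $ 1"

lemma cross2_commute: "cross2 y x = - cross2 x y"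
  by (simp add: cross2_def)

lemma inner_mult_inner_diff:
  "(a \<bullet> b) * (c \<bullet> d) - (a \<bullet> c) * (b \<bullet> d) = cross2 a d * cross2 b c"
  by (simp add: cross2_def inner_vec_def sum_2 algebra_simps)

text \<open>\<open>c\<close> and \<open>d\<close> lie in the cone cut out by the half-planes with
  normals \<open>a\<close> and \<open>b\<close>; these normals are more than a right angle apart, so
  the cone is narrower than a right angle.\<close>

lemma inner_pos_if_obtuse_between:
  fixes a b c d :: "real ^ 2"
  assumes "a \<bullet> b < 0" and "0 < a \<bullet> c" "0 < a \<bullet> d" "0 < b \<bullet> c" "0 < b \<bullet> d"
  shows "0 < c \<bullet> d"
proof -
  have lagrange: "(a \<bullet> x) * (a \<bullet> y) + cross2 a x * cross2 a y = (a \<bullet> a) * (x \<bullet> y)" for x y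
    by (simp add: cross2_def inner_vec_def sum_2 algebra_simps)
  have pos: "0 < cross2 a b * cross2 a x" if "0 < a \<bullet> x" "0 < b \<bullet> x" for x
  proof -
    have "0 \<le> (a \<bullet> a) * (b \<bullet> x)" and "(a \<bullet> b) * (a \<bullet> x) < 0"
      using that assms(1) by (simp_all add: mult_neg_pos)
    then show ?thesis using lagrange[of b x] by linarith
  qed
  have "0 < cross2 a c * cross2 a d"
    using pos[of c] pos[of d] assms by (auto simp: zero_less_mult_iff)
  moreover have "0 < (a \<bullet> c) * (a \<bullet> d)"
    using assms by simp
  ultimately have "0 < (a \<bullet> a) * (c \<bullet> d)"
    using lagrange[of c d] by linarith
  then show ?thesis
    by (metis inner_ge_zero linorder_not_less zero_less_mult_iff)
qed

lemma cross2_mult_neg: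
  fixes a b c d :: "real ^ 2"
  assumes "0 < t" and "a \<bullet> b < t" "c \<bullet> d < t"
    and "t \<le> a \<bullet> c" "t \<le> a \<bullet> d" "t \<le> b \<bullet> c" "t \<le> b \<bullet> d"
  shows "cross2 a d * cross2 b c < 0"
proof -
  have "t * t \<le> (a \<bullet> c) * (b \<bullet> d)"
    using assms by (intro mult_mono) auto
  moreover have "(a \<bullet> b) * (c \<bullet> d) < t * t"
  proof (cases "a \<bullet> b < 0")
    case True
    with inner_pos_if_obtuse_between[of a b c d] assms have "0 < c \<bullet> d" by simp
    then have "(a \<bullet> b) * (c \<bullet> d) < 0" using True by (simp add: mult_neg_pos)
    then show ?thesis using assms(1) by (meson less_trans mult_pos_pos)
  next
    case False
    \<comment> \<open>Here \<open>c \<bullet> d\<close> may be negative; only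
      \<open>a \<bullet> b\<close> must be nonnegative.\<close>
    then have "(a \<bullet> b) * (c \<bullet> d) \<le> (a \<bullet> b) * t"
      using assms by (intro mult_left_mono) auto
    also have "\<dots> < t * t"
      using assms by simp
    finally show ?thesis .
  qed
  ultimately show ?thesis
    using inner_mult_inner_diff[of a b c d] by linarith
qed

text \<open>\<open>a\<close> and \<open>b\<close> lie strictly on the same side of the line through \<open>0\<close> and \<open>c\<close>.\<close>

definition same_side :: "real ^ 2 \<Rightarrow> real ^ 2 \<Rightarrow> real ^ 2 \<Rightarrow> bool" where
  "same_side a b c \<longleftrightarrow> 0 < cross2 a c * cross2 b c"

lemma same_side_compatible:
  fixes a b c d :: "real ^ 2"
  assumes "0 < t" and "a \<bullet> b < t" "c \<bullet> d < t"
    and "t \<le> a \<bullet> c" "t \<le> a \<bullet> d" "t \<le> b \<bullet> c" "t \<le> b \<bullet> d"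
  shows "same_side a b d \<longleftrightarrow> same_side a b c" and "same_side c d a \<longleftrightarrow> \<not> same_side a b c"
proof -
  have "cross2 a d * cross2 b c < 0"
    using assms by (rule cross2_mult_neg)
  moreover have "cross2 a c * cross2 b d < 0"
    using assms by (intro cross2_mult_neg[of t]) (simp_all add: inner_commute)
  ultimately show "same_side a b d \<longleftrightarrow> same_side a b c" and "same_side c d a \<longleftrightarrow> \<not> same_side a b c"
    unfolding same_side_def cross2_commute[of c a] cross2_commute[of d a]
    by (auto simp: zero_less_mult_iff mult_less_0_iff)
qed

lemma not_dot_product_graph_anti_cycle_ge_7:
  assumes "7 \<le> n"
  shows "\<not> dot_product_graph TYPE(2) (anti_cycle n)"
proof
  assume "dot_product_graph TYPE(2) (anti_cycle n)"
  then obtain a :: "nat \<Rightarrow> real ^ 2" and t where t: "0 < t"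
    and a: "u < n \<Longrightarrow> v < n \<Longrightarrow> u \<noteq> v \<Longrightarrow>
      t \<le> a u \<bullet> a v \<longleftrightarrow> v \<noteq> (u + 1) mod n \<and> u \<noteq> (v + 1) mod n" for u v
    unfolding dot_product_graph_anti_cycle_iff by blast
  \<comment> \<open>The periodic extension turns cyclic index arithmetic into plain shifts.\<close>
  define w where "w i = a (i mod n)" for i
  have mod_add_neq: "(i + k) mod n \<noteq> i mod n" if "0 < k" "k < n" for i k
  proof
    assume "(i + k) mod n = i mod n"
    then have "n dvd k" using mod_eq_dvd_iff_nat[of i "i + k" n] by simp
    with that show False by (simp add: nat_dvd_not_less)
  qed
  have periodic: "w (i + n) = w i" for i
    by (simp add: w_def)
  have mod_less: "i mod n < n" for i
    using assms by simp
  have nonadj: "w i \<bullet> w (i + 1) < t" for i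
  proof -
    have "\<not> t \<le> a (i mod n) \<bullet> a ((i + 1) mod n)"
      using a[OF mod_less mod_less, of i "i + 1"] mod_add_neq[of 1 i] assms
      by (metis mod_add_left_eq less_le_trans one_less_numeral_iff semiring_norm(77) zero_less_one)
    then show ?thesis by (simp add: w_def)
  qed
  have adj: "t \<le> w i \<bullet> w (i + k)" if "2 \<le> k" "k + 2 \<le> n" for i k
  proof -
    have "(i + k) mod n \<noteq> i mod n"
      using mod_add_neq[of k i] that by simp
    moreover have "(i + k) mod n \<noteq> (i mod n + 1) mod n"
      using mod_add_neq[of "k - 1" "i + 1"] that by (simp add: mod_simps)
    moreover have "i mod n \<noteq> ((i + k) mod n + 1) mod n"
      using mod_add_neq[of "k + 1" i] that by (simp add: mod_simps)
    ultimately show ?thesis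
      unfolding w_def using a[OF mod_less mod_less, of i "i + k"] by metis
  qed
  have adj_gap: "t \<le> w i \<bullet> w j" if "i + 2 \<le> j" "j + 2 \<le> i + n" for i j
    using adj[of "j - i" i] that by simp
  have compatible:
      "same_side (w k) (w (k + 1)) (w (k + i + 1)) \<longleftrightarrow> same_side (w k) (w (k + 1)) (w (k + i))"
      "same_side (w (k + i)) (w (k + i + 1)) (w k) \<longleftrightarrow> \<not> same_side (w k) (w (k + 1)) (w (k + i))"
    if "3 \<le> i" "i + 3 \<le> n" for k i
    using that
    by (intro same_side_compatible[OF t] nonadj adj_gap; simp)+
  define inner_edge where
    "inner_edge k \<longleftrightarrow> same_side (w k) (w (k + 1)) (w (k + 3))" for k
  \<comment> \<open>The range of \<open>i\<close> reaches one further than in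
    \<open>compatible\<close>, whose first part passes from \<open>i\<close> to
    \<open>i + 1\<close>.\<close>
  have inner_edge: "same_side (w k) (w (k + 1)) (w (k + i)) \<longleftrightarrow> inner_edge k"
    if "3 \<le> i" "i + 2 \<le> n" for k i
    using that
  proof (induction i rule: dec_induct)
    case base
    show ?case by (simp add: inner_edge_def)
  next
    case (step i)
    then show ?case using compatible(1)[of i k] by simp
  qed
  \<comment> \<open>From \<open>k + i\<close>, another \<open>n - i\<close> steps lead back to
    \<open>w k\<close>, so \<open>w k\<close> can serve as the test vector for the type of
    \<open>k + i\<close>.\<close>
  have flip: "inner_edge (k + i) \<longleftrightarrow> \<not> inner_edge k" if "3 \<le> i" "i + 3 \<le> n" for k i
    using compatible(2)[OF that, of k] inner_edge[of i k] inner_edge[of "n - i" "k + i"]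
      periodic[of k] that by simp
  \<comment> \<open>The flip by 4 is where \<open>7 \<le> n\<close> enters.\<close>
  have "inner_edge (k + 4) \<longleftrightarrow> inner_edge (k + 3)" for k
    using flip[of 3 k] flip[of 4 k] assms by simp
  from this[of 0] this[of 1] this[of 2] flip[of 3 3] assms show False
    by simp
qed

theorem theorem9:
  fixes n :: nat
  assumes "n \<ge> 2"
  shows "(n \<le> 6 \<longrightarrow> dot_product_graph TYPE(2) (anti_cycle n)) \<and>
         (n \<ge> 7 \<longrightarrow> \<not> dot_product_graph TYPE(2) (anti_cycle n))"
  using assms dot_product_graph_anti_cycle_le_6 not_dot_product_graph_anti_cycle_ge_7 by blast

end
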